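(* Let $d>2$ be an integer and let $(M,d)$ be the system of congruences $$y_0+y_1+y_2\equiv0\pmod d,\qquad a_{1,1}y_1+a_{1,2}y_2\equiv0\pmod d,$$ where $0\le a_{1,1},a_{1,2}<d$ are integers with $\gcd(a_{1,1},a_{1,2},d)=1$. Set $a'=\frac{a_{1,1}}{\gcd(a_{1,1},d)}$, $d'=\frac{d}{\gcd(a_{1,1},d)}$, and let $0<\lambda\le d'$ be the integer such that $a_{1,2}=\lambda a'+\mu d'$ with $\mu\in\mathbb{Z}$. Let $\mathcal{A}\subset\mathbb{Z}_{\ge0}^2$ be the $GT$-subset of $(M,d)$. Then the phase transition $n_0(\mathcal{A})$ is zero and, for all $t\ge0$, $$\varphi_{\mathcal{A}}(t)=p_{\mathcal{A}}(t)=\frac{dt^2+\theta(a_{1,1},a_{1,2},d)\,t+2}{2},$$ where $\theta(a_{1,1},a_{1,2},d)=\gcd(a_{1,1},d)+\gcd(\lambda,d')+\gcd(\lambda-\gcd(a_{1,1},d),d')$.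
   Context: The $GT$-subset of $(M,d)$ is $\mathcal{A}=\{(y_1,y_2)\mid (y_0,y_1,y_2)\in\mathbb{Z}_{\ge0}^3,\ y_0+y_1+y_2=d,\ a_{1,1}y_1+a_{1,2}y_2\equiv0\pmod d\}\subset\mathbb{Z}_{\ge0}^2$. For $t\ge1$, $t\mathcal{A}$ is the set of sums of $t$ (not necessarily distinct) elements of $\mathcal{A}$, $0\mathcal{A}=\{0\}$, and $\varphi_{\mathcal{A}}(t)=|t\mathcal{A}|$. There is a polynomial $p_{\mathcal{A}}\in\mathbb{Q}[t]$ with $\varphi_{\mathcal{A}}(t)=p_{\mathcal{A}}(t)$ for $t\gg0$ (Khovanskii), and the phase transition is $n_0(\mathcal{A})=\min\{n_0\in\mathbb{Z}_{\ge0}\mid\varphi_{\mathcal{A}}(t)=p_{\mathcal{A}}(t)\ \forall t\ge n_0\}$. *)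

theory Defs
  imports
    "HOL-Library.Product_Plus"
    "HOL-Computational_Algebra.Polynomial"
    "HOL-Number_Theory.Cong"
begin

definition GT_subset :: "int \<Rightarrow> int \<Rightarrow> int \<Rightarrow> (nat \<times> nat) set" where
  "GT_subset a11 a12 d =
     {(y1, y2) | y0 y1 y2. int y0 + int y1 + int y2 = d \<and>
        [a11 * int y1 + a12 * int y2 = 0] (mod d)}"

definition iterated_sumset :: "nat \<Rightarrow> 'a::comm_monoid_add set \<Rightarrow> 'a set" where
  "iterated_sumset t A = {(\<Sum>i<t. f i) | f. \<forall>i<t. f i \<in> A}"

lemma iterated_sumset_0: "iterated_sumset 0 A = {0}"
  by (simp add: iterated_sumset_def)

definition sumset_card :: "'a::comm_monoid_add set \<Rightarrow> nat \<Rightarrow> nat" where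
  "sumset_card A t = card (iterated_sumset t A)"

(* Existence for finite A is Khovanskii's theorem; uniqueness is the lemma below. *)
definition khovanskii_poly :: "'a::comm_monoid_add set \<Rightarrow> rat poly" where
  "khovanskii_poly A =
     (THE p. \<forall>\<^sub>F t in sequentially. of_nat (sumset_card A t) = poly p (of_nat t))"

definition phase_transition :: "'a::comm_monoid_add set \<Rightarrow> nat" where
  "phase_transition A =
     (LEAST n0. \<forall>t\<ge>n0. of_nat (sumset_card A t) = poly (khovanskii_poly A) (of_nat t))"

lemma khovanskii_poly_eqI:
  fixes p :: "rat poly"
  assumes "\<forall>\<^sub>F t in sequentially. of_nat (sumset_card A t) = poly p (of_nat t)"
  shows "khovanskii_poly A = p"
  unfolding khovanskii_poly_def
proof (rule the_equality)
  fix q :: "rat poly" assume "\<forall>\<^sub>F t in sequentially. of_nat (sumset_card A t) = poly q (of_nat t)"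
  with assms have "\<forall>\<^sub>F t in sequentially. poly (q - p) (of_nat t) = 0"
    by eventually_elim simp
  then obtain N where N: "poly (q - p) (of_nat t) = 0" if "t \<ge> N" for t
    unfolding eventually_sequentially by blast
  have "of_nat ` {N..} \<subseteq> {x. poly (q - p) x = 0}"
    using N by auto
  moreover have "infinite (of_nat ` {N..} :: rat set)"
    by (simp add: finite_image_iff infinite_Ici inj_on_def)
  ultimately have "infinite {x. poly (q - p) x = 0}"
    by (rule infinite_super)
  then have "q - p = 0"
    using poly_roots_finite by metis
  then show "q = p" by simp
qed (fact assms)

(* The integer lambda of the theorem exists and is unique. *)
lemma lambda_ex1:
  fixes a11 a12 d a' d' :: int
  assumes "d > 0" and a': "a' = a11 div gcd a11 d" and d': "d' = d div gcd a11 d"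
  shows "\<exists>!lam. 0 < lam \<and> lam \<le> d' \<and> (\<exists>mu. a12 = lam * a' + mu * d')"
proof -
  have g: "gcd a11 d > 0" using assms(1) by (simp add: order_less_le)
  have cop: "coprime a' d'" unfolding a' d' using assms(1) by (intro div_gcd_coprime) auto
  have pos: "d' > 0" unfolding d' using assms(1) g gcd_le2_int[of d a11]
    by (simp add: pos_imp_zdiv_pos_iff)
  from cop obtain u where u: "[a' * u = 1] (mod d')"
    using cong_solve_coprime_int by blast
  define r where "r = (u * a12 - 1) mod d' + 1"
  have "[r = (u * a12 - 1) + 1] (mod d')"
    unfolding r_def by (intro cong_add) (auto simp: cong_def)
  then have "[r * a' = u * a12 * a'] (mod d')"
    by (intro cong_scalar_right) simp
  also have "[u * a12 * a' = 1 * a12] (mod d')"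
    using cong_scalar_right[OF u, of a12] by (simp add: mult_ac)
  finally obtain k where "a12 = r * a' + d' * k"
    by (auto simp: cong_iff_lin)
  then have "a12 = r * a' + k * d'" by (simp add: mult.commute)
  moreover have "0 < r" "r \<le> d'"
    using pos_mod_bound[OF pos, of "u * a12 - 1"] pos_mod_sign[OF pos, of "u * a12 - 1"]
    unfolding r_def by linarith+
  moreover have "x = y"
    if "0 < x" "x \<le> d'" "0 < y" "y \<le> d'" "a12 = x * a' + m * d'" "a12 = y * a' + n * d'"
    for x y m n
  proof -
    have "(x - y) * a' = (n - m) * d'" using that by (simp add: algebra_simps)
    then have "d' dvd (x - y) * a'" by simp
    then have "d' dvd x - y"
      using cop by (simp add: coprime_dvd_mult_left_iff coprime_commute)
    moreover have "\<bar>x - y\<bar> < d'" using that by linarith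
    ultimately have "x - y = 0"
      by (meson dvd_imp_le_int not_le pos abs_of_pos abs_ge_self order.strict_trans2)
    then show ?thesis by simp
  qed
  ultimately show ?thesis by (intro ex1I[of _ r]) blast+
qed

end

theory Submission
  imports Defs
begin

text \<open>
  Dropping the first coordinate, the GT-subset consists of the points of the lattice
  \<open>L = {(x, y). d dvd a11 * x + a12 * y}\<close> in the triangle \<open>\<Delta>\<close> with vertices \<open>(0, 0)\<close>,
  \<open>(d, 0)\<close>, \<open>(0, d)\<close>, and these vertices belong to \<open>L\<close>. The theorem is therefore a statement
  about a lattice triangle, and has two halves.

  \<^item> The \<open>t\<close>-fold sumset is all of \<open>L \<inter> t\<Delta>\<close>: plane lattice polygons are normal. Subtracting a
  vertex takes a lattice point of \<open>(t + 1)\<Delta>\<close>, \<open>t \<ge> 1\<close>, to one of \<open>t\<Delta>\<close>, unless \<open>t = 1\<close> and the point is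
  \<open>p + q + r - c\<close> for the vertices \<open>p, q, r\<close> of \<open>\<Delta>\<close> and an interior lattice point \<open>c\<close>. Such points
  are split by a descent through ever smaller lattice triangles
  (\<open>split_vertex_sum_minus_point\<close>), which plays the role of a unimodular triangulation.

  \<^item> The number of points of \<open>L \<inter> t\<Delta>\<close> follows from a symmetry (\<open>card_triangle_points\<close>): the
  triangle and its point reflection cover the square \<open>[0, td]\<^sup>2\<close> and meet in its antidiagonal, so
  twice the count is the number of lattice points of the square plus that of the antidiagonal.
  The half-open square has \<open>t\<^sup>2 d\<close> lattice points because \<open>L\<close> has index \<open>d\<close>. The two added sides
  and the antidiagonal contribute \<open>gcd a11 d\<close>, \<open>gcd a12 d\<close> and \<open>gcd (a12 - a11) d\<close> points per unit
  of \<open>t\<close>.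

  It remains to express the last two gcds through \<open>lam\<close> and \<open>d'\<close>. Both are coprime to \<open>gcd a11 d\<close>,
  so \<open>d\<close> may be replaced by \<open>d'\<close>; modulo \<open>d'\<close> the numbers \<open>a12\<close> and \<open>a12 - a11\<close> are \<open>lam * a'\<close> and
  \<open>(lam - gcd a11 d) * a'\<close>, and \<open>a'\<close> is a unit. As the count is polynomial from \<open>t = 0\<close> on, the phase
  transition is zero.
\<close>

section \<open>Splitting lattice points of a dilated triangle\<close>

definition weight_lattice :: "int \<Rightarrow> int \<Rightarrow> int \<Rightarrow> (int \<times> int) set" where
  "weight_lattice a b d = {(x, y). d dvd a * x + b * y}"

definition triangle_points :: "int \<Rightarrow> int \<Rightarrow> int \<Rightarrow> int \<Rightarrow> (int \<times> int) set" where
  "triangle_points a b d s =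
     {(x, y). 0 \<le> x \<and> 0 \<le> y \<and> x + y \<le> s} \<inter> weight_lattice a b d"

lemma weight_lattice_add:
  assumes "u \<in> weight_lattice a b d" "v \<in> weight_lattice a b d"
  shows "u + v \<in> weight_lattice a b d"
proof -
  have "d dvd a * fst u + b * snd u" "d dvd a * fst v + b * snd v"
    using assms by (simp_all add: weight_lattice_def case_prod_unfold)
  then have "d dvd (a * fst u + b * snd u) + (a * fst v + b * snd v)" by (rule dvd_add)
  then show ?thesis
    by (simp add: weight_lattice_def case_prod_unfold algebra_simps)
qed

lemma weight_lattice_diff:
  assumes "u \<in> weight_lattice a b d" "v \<in> weight_lattice a b d"
  shows "u - v \<in> weight_lattice a b d"
proof -
  have "d dvd a * fst u + b * snd u" "d dvd a * fst v + b * snd v"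
    using assms by (simp_all add: weight_lattice_def case_prod_unfold)
  then have "d dvd (a * fst u + b * snd u) - (a * fst v + b * snd v)" by (rule dvd_diff)
  then show ?thesis
    by (simp add: weight_lattice_def case_prod_unfold algebra_simps)
qed

text \<open>
  The barycentric coordinates of \<open>c\<close> in the triangle \<open>p q r\<close> are \<open>\<alpha>/n\<close>, \<open>\<beta>/n\<close>, \<open>\<gamma>/n\<close>. Clearing the
  denominator keeps everything integral and makes \<open>n\<close> available as a termination measure. The
  triangle may be degenerate, and the fraction need not be reduced.
\<close>
definition barycentric :: "int \<Rightarrow> int \<Rightarrow> int \<Rightarrow> int \<Rightarrow>
    int \<times> int \<Rightarrow> int \<times> int \<Rightarrow> int \<times> int \<Rightarrow> int \<times> int \<Rightarrow> bool" where
  "barycentric \<alpha> \<beta> \<gamma> n p q r c \<longleftrightarrow>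
     0 \<le> \<alpha> \<and> 0 \<le> \<beta> \<and> 0 \<le> \<gamma> \<and> 0 < n \<and> \<alpha> + \<beta> + \<gamma> = n \<and>
     n * fst c = \<alpha> * fst p + \<beta> * fst q + \<gamma> * fst r \<and>
     n * snd c = \<alpha> * snd p + \<beta> * snd q + \<gamma> * snd r"

lemma triangle_points_convex:
  assumes "barycentric \<alpha> \<beta> \<gamma> n p q r c"
    and "p \<in> triangle_points a b d s" "q \<in> triangle_points a b d s"
      "r \<in> triangle_points a b d s" "c \<in> weight_lattice a b d"
  shows "c \<in> triangle_points a b d s"
proof -
  have nonneg: "0 \<le> \<alpha>" "0 \<le> \<beta>" "0 \<le> \<gamma>" and n: "0 < n" and sum: "\<alpha> + \<beta> + \<gamma> = n"
    and c1: "n * fst c = \<alpha> * fst p + \<beta> * fst q + \<gamma> * fst r"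
    and c2: "n * snd c = \<alpha> * snd p + \<beta> * snd q + \<gamma> * snd r"
    using assms(1) by (simp_all add: barycentric_def)
  have pts: "0 \<le> fst v" "0 \<le> snd v" "0 \<le> s - fst v - snd v" if "v \<in> {p, q, r}" for v
    using assms that by (auto simp: triangle_points_def)
  have "0 \<le> n * fst c" "0 \<le> n * snd c"
    unfolding c1 c2 using nonneg pts by simp_all
  moreover have "n * (s - fst c - snd c) = \<alpha> * (s - fst p - snd p)
      + \<beta> * (s - fst q - snd q) + \<gamma> * (s - fst r - snd r)"
    using c1 c2 sum[symmetric] by (simp add: algebra_simps)
  then have "0 \<le> n * (s - fst c - snd c)"
    using nonneg pts by simp
  ultimately have "0 \<le> fst c" "0 \<le> snd c" "0 \<le> s - fst c - snd c"
    using n by (simp_all add: zero_le_mult_iff)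
  then show ?thesis
    using assms(5) by (simp add: triangle_points_def case_prod_unfold)
qed

text \<open>
  If no barycentric coordinate of \<open>c\<close> exceeds \<open>1/2\<close>, then \<open>c\<close> and \<open>p + q + r - 2c\<close> both lie in the
  triangle and the splitting is immediate. If the coordinate \<open>\<alpha>/n\<close> of \<open>p\<close> exceeds \<open>1/2\<close>, replace
  \<open>p\<close> by \<open>c\<close> and \<open>c\<close> by its reflection \<open>2c - p\<close>. The point to be split stays the same, since
  \<open>c + q + r - (2c - p) = p + q + r - c\<close>, and the new \<open>c\<close> lies in the new triangle, with weights
  \<open>2\<alpha> - n, \<beta>, \<gamma>\<close> of sum \<open>\<alpha>\<close>. So the denominator drops from \<open>n\<close> to \<open>\<alpha>\<close>, except when \<open>\<alpha> = n\<close>;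
  then \<open>c = p\<close>, and the splitting is \<open>q + r\<close>.
\<close>
lemma split_vertex_sum_minus_point:
  assumes "barycentric \<alpha> \<beta> \<gamma> n p q r c"
    and "p \<in> triangle_points a b d s" "q \<in> triangle_points a b d s"
      "r \<in> triangle_points a b d s" "c \<in> weight_lattice a b d"
  shows "\<exists>u v. u \<in> triangle_points a b d s \<and> v \<in> triangle_points a b d s \<and> u + v = p + q + r - c"
  using assms
proof (induction "nat n" arbitrary: \<alpha> \<beta> \<gamma> n p q r c rule: less_induct)
  case less
  let ?T = "triangle_points a b d s"
  let ?goal = "\<lambda>w. \<exists>u v. u \<in> ?T \<and> v \<in> ?T \<and> u + v = w"
  have lat: "v \<in> weight_lattice a b d" if "v \<in> ?T" for v
    using that by (simp add: triangle_points_def)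
  have descent: "?goal (p' + q' + r' - c)"
    if bc: "barycentric \<alpha>' \<beta>' \<gamma>' n p' q' r' c" and T: "p' \<in> ?T" "q' \<in> ?T" "r' \<in> ?T"
      and large: "n < 2 * \<alpha>'" for \<alpha>' \<beta>' \<gamma>' p' q' r'
  proof (cases "\<alpha>' = n")
    case True
    then have "\<beta>' = 0" "\<gamma>' = 0" "n > 0" using bc by (auto simp: barycentric_def)
    then have "c = p'" using bc True by (auto simp: barycentric_def prod_eq_iff)
    then show ?thesis using T by (intro exI[of _ q'] exI[of _ r']) simp
  next
    case False
    have "\<alpha>' < n" using bc False by (auto simp: barycentric_def)
    have cT: "c \<in> ?T" using triangle_points_convex[OF bc T less.prems(5)] .
    have "barycentric (2 * \<alpha>' - n) \<beta>' \<gamma>' \<alpha>' c q' r' (c + c - p')"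
      using bc large unfolding barycentric_def by (auto simp: algebra_simps)
    moreover have "c + c - p' \<in> weight_lattice a b d"
      by (intro weight_lattice_diff weight_lattice_add lat cT T)
    moreover have "nat \<alpha>' < nat n" using \<open>\<alpha>' < n\<close> bc by (auto simp: barycentric_def)
    ultimately have "?goal (c + q' + r' - (c + c - p'))"
      using less.hyps cT T by blast
    then show ?thesis by (simp add: algebra_simps)
  qed
  have bc: "barycentric \<alpha> \<beta> \<gamma> n p q r c" by fact
  then have perm: "barycentric \<beta> \<alpha> \<gamma> n q p r c" "barycentric \<gamma> \<alpha> \<beta> n r p q c"
    by (auto simp: barycentric_def)
  consider "n < 2 * \<alpha>" | "n < 2 * \<beta>" | "n < 2 * \<gamma>"
    | "2 * \<alpha> \<le> n" "2 * \<beta> \<le> n" "2 * \<gamma> \<le> n" by linarith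
  then show ?case
  proof cases
    case 1
    then show ?thesis using descent[OF bc] less.prems by blast
  next
    case 2
    then show ?thesis using descent[OF perm(1)] less.prems by (simp add: add.commute)
  next
    case 3
    then show ?thesis using descent[OF perm(2)] less.prems by (simp add: ac_simps)
  next
    case 4
    have cT: "c \<in> ?T" using triangle_points_convex less.prems by blast
    let ?v = "p + q + r - c - c"
    have "barycentric (n - 2 * \<alpha>) (n - 2 * \<beta>) (n - 2 * \<gamma>) n p q r ?v"
      using bc 4 unfolding barycentric_def by (auto simp: algebra_simps)
    moreover have "?v \<in> weight_lattice a b d"
      by (intro weight_lattice_diff weight_lattice_add lat less.prems cT)
    ultimately have "?v \<in> ?T" using triangle_points_convex less.prems by blast
    then show ?thesis using cT by (intro exI[of _ c] exI[of _ ?v]) simp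
  qed
qed

text \<open>
  If no vertex can be subtracted, then for \<open>y = (y1, y2)\<close> the numbers \<open>y1\<close>, \<open>y2\<close> and
  \<open>(t + 1) d - y1 - y2\<close> are all below \<open>d\<close>, which
  leaves only \<open>t = 1\<close> once \<open>t = 0\<close> is set aside. There the descent applies to
  \<open>c = (d - y1, d - y2)\<close>.
\<close>
lemma triangle_points_Suc_split:
  assumes "d > 0" and y: "y \<in> triangle_points a b d (int (Suc t) * d)"
  shows "\<exists>u v. u \<in> triangle_points a b d d \<and> v \<in> triangle_points a b d (int t * d) \<and> y = u + v"
proof -
  obtain y1 y2 where y12: "y = (y1, y2)" by fastforce
  have ge: "0 \<le> y1" "0 \<le> y2" and le: "y1 + y2 \<le> int t * d + d"
    and lat: "d dvd a * y1 + b * y2"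
    using y by (auto simp: y12 triangle_points_def weight_lattice_def algebra_simps)
  have vertices: "(0, 0) \<in> triangle_points a b d d" "(d, 0) \<in> triangle_points a b d d"
      "(0, d) \<in> triangle_points a b d d"
    using assms(1) by (auto simp: triangle_points_def weight_lattice_def)
  have lat1: "d dvd a * (y1 - d) + b * y2" and lat2: "d dvd a * y1 + b * (y2 - d)"
    using lat by (simp_all add: right_diff_distrib diff_add_eq add_diff_eq dvd_diff)
  consider "t = 0" | "y1 \<ge> d" | "y2 \<ge> d" | "y1 + y2 \<le> int t * d"
    | "t \<noteq> 0" "y1 < d" "y2 < d" "int t * d < y1 + y2" by linarith
  then show ?thesis
  proof cases
    case 1
    then show ?thesis using y
      by (intro exI[of _ y] exI[of _ "(0, 0)"])
        (auto simp: triangle_points_def weight_lattice_def y12)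
  next
    case 2
    then have "(y1 - d, y2) \<in> triangle_points a b d (int t * d)"
      using ge le lat1 by (auto simp: triangle_points_def weight_lattice_def)
    then show ?thesis using vertices(2)
      by (intro exI[of _ "(d, 0)"] exI[of _ "(y1 - d, y2)"]) (simp add: y12)
  next
    case 3
    then have "(y1, y2 - d) \<in> triangle_points a b d (int t * d)"
      using ge le lat2 by (auto simp: triangle_points_def weight_lattice_def)
    then show ?thesis using vertices(3)
      by (intro exI[of _ "(0, d)"] exI[of _ "(y1, y2 - d)"]) (simp add: y12)
  next
    case 4
    then have "y \<in> triangle_points a b d (int t * d)"
      using ge lat by (auto simp: triangle_points_def weight_lattice_def y12)
    then show ?thesis using vertices(1)
      by (intro exI[of _ "(0, 0)"] exI[of _ y]) (simp add: y12)
  next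
    case 5
    have "t = 1"
    proof (rule ccontr)
      assume "t \<noteq> 1"
      then have "2 \<le> int t" using 5 by simp
      then have "2 * d \<le> int t * d" using assms(1) by (intro mult_right_mono) auto
      then show False using 5 by linarith
    qed
    let ?c = "(d - y1, d - y2)"
    have "barycentric (y1 + y2 - d) (d - y1) (d - y2) d (0, 0) (d, 0) (0, d) ?c"
      using 5 \<open>t = 1\<close> assms(1) by (simp add: barycentric_def mult.commute)
    moreover have "d dvd (a * d + b * d) - (a * y1 + b * y2)"
      by (rule dvd_diff[OF _ lat]) simp
    then have "?c \<in> weight_lattice a b d"
      by (simp add: weight_lattice_def algebra_simps)
    ultimately obtain u v where "u \<in> triangle_points a b d d" "v \<in> triangle_points a b d d"
        "u + v = (0, 0) + (d, 0) + (0, d) - ?c"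
      using split_vertex_sum_minus_point vertices by blast
    then show ?thesis using \<open>t = 1\<close> y12 by (intro exI[of _ u] exI[of _ v]) simp
  qed
qed

section \<open>Sumsets of the GT-subset\<close>

lemma mem_GT_subset_iff:
  "(x, y) \<in> GT_subset a b d \<longleftrightarrow> (int x, int y) \<in> triangle_points a b d d"
proof
  assume "(x, y) \<in> GT_subset a b d"
  then show "(int x, int y) \<in> triangle_points a b d d"
    by (auto simp: GT_subset_def triangle_points_def weight_lattice_def cong_0_iff)
next
  assume "(int x, int y) \<in> triangle_points a b d d"
  then have "int (nat (d - int x - int y)) + int x + int y = d"
      "[a * int x + b * int y = 0] (mod d)"
    by (auto simp: triangle_points_def weight_lattice_def cong_0_iff)
  then show "(x, y) \<in> GT_subset a b d" unfolding GT_subset_def by blast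
qed

lemma iterated_sumset_Suc:
  "iterated_sumset (Suc t) A = {u + v | u v. u \<in> iterated_sumset t A \<and> v \<in> A}"
proof (intro equalityI subsetI)
  fix x assume "x \<in> iterated_sumset (Suc t) A"
  then show "x \<in> {u + v | u v. u \<in> iterated_sumset t A \<and> v \<in> A}"
    unfolding iterated_sumset_def by fastforce
next
  fix x assume "x \<in> {u + v | u v. u \<in> iterated_sumset t A \<and> v \<in> A}"
  then obtain f v where f: "\<forall>i<t. f i \<in> A" and "v \<in> A" and x: "x = (\<Sum>i<t. f i) + v"
    unfolding iterated_sumset_def by blast
  let ?f = "f(t := v)"
  have "x = (\<Sum>i<Suc t. ?f i)" using x by simp
  moreover have "\<forall>i<Suc t. ?f i \<in> A" using f \<open>v \<in> A\<close> by (simp add: less_Suc_eq)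
  ultimately show "x \<in> iterated_sumset (Suc t) A" unfolding iterated_sumset_def by blast
qed

lemma mem_iterated_sumset_GT_subset_iff:
  assumes "d > 0"
  shows "(x, y) \<in> iterated_sumset t (GT_subset a b d) \<longleftrightarrow>
    (int x, int y) \<in> triangle_points a b d (int t * d)"
proof (induction t arbitrary: x y)
  case 0
  show ?case
    by (auto simp: iterated_sumset_0 triangle_points_def weight_lattice_def zero_prod_def)
next
  case (Suc t)
  show ?case
  proof
    assume "(x, y) \<in> iterated_sumset (Suc t) (GT_subset a b d)"
    then obtain x1 y1 x2 y2 where xy: "x = x1 + x2" "y = y1 + y2"
      and "(x1, y1) \<in> iterated_sumset t (GT_subset a b d)" "(x2, y2) \<in> GT_subset a b d"
      unfolding iterated_sumset_Suc by auto
    then have T: "(int x1, int y1) \<in> triangle_points a b d (int t * d)"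
        "(int x2, int y2) \<in> triangle_points a b d d"
      by (simp_all add: Suc mem_GT_subset_iff)
    then have "(int x1, int y1) + (int x2, int y2) \<in> weight_lattice a b d"
      by (intro weight_lattice_add) (simp_all add: triangle_points_def)
    then show "(int x, int y) \<in> triangle_points a b d (int (Suc t) * d)"
      using T by (simp add: xy triangle_points_def algebra_simps)
  next
    assume "(int x, int y) \<in> triangle_points a b d (int (Suc t) * d)"
    then obtain u v where u: "u \<in> triangle_points a b d d"
      and v: "v \<in> triangle_points a b d (int t * d)" and eq: "(int x, int y) = u + v"
      using triangle_points_Suc_split[OF assms] by blast
    define u1 u2 v1 v2 where "u1 = nat (fst u)" "u2 = nat (snd u)"
      "v1 = nat (fst v)" "v2 = nat (snd v)"
    have uv: "u = (int u1, int u2)" "v = (int v1, int v2)"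
      using u v by (auto simp: u1_u2_v1_v2_def triangle_points_def)
    have "(v1, v2) \<in> iterated_sumset t (GT_subset a b d)" "(u1, u2) \<in> GT_subset a b d"
      using u v by (simp_all add: Suc mem_GT_subset_iff uv)
    moreover have "(x, y) = (v1, v2) + (u1, u2)" using eq by (auto simp: uv)
    ultimately show "(x, y) \<in> iterated_sumset (Suc t) (GT_subset a b d)"
      unfolding iterated_sumset_Suc by blast
  qed
qed

lemma sumset_card_GT_subset:
  assumes "d > 0"
  shows "sumset_card (GT_subset a b d) t = card (triangle_points a b d (int t * d))"
proof -
  have "bij_betw (map_prod int int) (iterated_sumset t (GT_subset a b d))
      (triangle_points a b d (int t * d))"
    unfolding bij_betw_def
  proof
    show "inj_on (map_prod int int) (iterated_sumset t (GT_subset a b d))"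
      by (auto simp: inj_on_def)
    show "map_prod int int ` iterated_sumset t (GT_subset a b d) = triangle_points a b d (int t * d)"
    proof (intro equalityI subsetI)
      fix z assume "z \<in> map_prod int int ` iterated_sumset t (GT_subset a b d)"
      then show "z \<in> triangle_points a b d (int t * d)"
        by (auto simp: mem_iterated_sumset_GT_subset_iff[OF assms])
    next
      fix z assume z: "z \<in> triangle_points a b d (int t * d)"
      then have eq: "z = map_prod int int (nat (fst z), nat (snd z))"
        by (auto simp: triangle_points_def)
      then have "(nat (fst z), nat (snd z)) \<in> iterated_sumset t (GT_subset a b d)"
        using z by (simp add: mem_iterated_sumset_GT_subset_iff[OF assms])
      then show "z \<in> map_prod int int ` iterated_sumset t (GT_subset a b d)"
        using eq by blast
    qed
  qed
  then show ?thesis unfolding sumset_card_def by (rule bij_betw_same_card)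
qed

section \<open>Counting solutions of linear congruences\<close>

text \<open>
  The interval is taken half-open and of length a multiple of the modulus, so that every residue
  class is hit equally often.
\<close>
lemma card_residue_class:
  fixes d m r :: int
  assumes "d > 0" "m \<ge> 0"
  shows "int (card {x \<in> {0..<m * d}. d dvd x - r}) = m"
proof -
  have "bij_betw (\<lambda>k. k * d + r mod d) {0..<m} {x \<in> {0..<m * d}. d dvd x - r}"
    unfolding bij_betw_def
  proof
    show "inj_on (\<lambda>k. k * d + r mod d) {0..<m}" using assms by (auto simp: inj_on_def)
    show "(\<lambda>k. k * d + r mod d) ` {0..<m} = {x \<in> {0..<m * d}. d dvd x - r}"
    proof (intro equalityI subsetI)
      fix x assume "x \<in> (\<lambda>k. k * d + r mod d) ` {0..<m}"
      then obtain k where k: "0 \<le> k" "k + 1 \<le> m" and x: "x = k * d + r mod d" by auto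
      have "0 \<le> k * d" "(k + 1) * d \<le> m * d"
        using k assms by (simp_all add: mult_right_mono)
      moreover have "0 \<le> r mod d" "r mod d < d" using assms by simp_all
      ultimately have "x \<in> {0..<m * d}" using x by (simp add: algebra_simps)
      moreover have "d dvd x - r" by (simp add: x mod_eq_dvd_iff[symmetric])
      ultimately show "x \<in> {x \<in> {0..<m * d}. d dvd x - r}" by simp
    next
      fix x assume x: "x \<in> {x \<in> {0..<m * d}. d dvd x - r}"
      then have "x mod d = r mod d" by (simp add: mod_eq_dvd_iff)
      then have "x = x div d * d + r mod d" using div_mult_mod_eq[of x d] by simp
      moreover have "0 \<le> x div d" using x assms by (simp add: pos_imp_zdiv_nonneg_iff)
      moreover have "x div d < m"
      proof -
        have "x div d * d \<le> x" using div_mult_mod_eq[of x d] pos_mod_sign[of d x] assms(1) by linarith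
        then have "x div d * d < m * d" using x by simp
        then show ?thesis using assms(1) by simp
      qed
      ultimately show "x \<in> (\<lambda>k. k * d + r mod d) ` {0..<m}" by auto
    qed
  qed
  then have "card {0..<m} = card {x \<in> {0..<m * d}. d dvd x - r}"
    by (rule bij_betw_same_card)
  then show ?thesis using assms by simp
qed

text \<open>
  After division by \<open>gcd a d\<close> the coefficient is invertible, so the solutions form one residue
  class modulo \<open>d / gcd a d\<close>.
\<close>
lemma card_linear_congruence:
  fixes a c d t :: int
  assumes "d > 0" "t \<ge> 0"
  shows "int (card {x \<in> {0..<t * d}. d dvd a * x + c}) = (if gcd a d dvd c then t * gcd a d else 0)"
proof (cases "gcd a d dvd c")
  case False
  have "\<not> d dvd a * x + c" for x
  proof
    assume "d dvd a * x + c"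
    then have "gcd a d dvd a * x + c" by (meson dvd_trans gcd_dvd2)
    then show False using False by (simp add: dvd_add_right_iff)
  qed
  then show ?thesis using False by simp
next
  case True
  define g where "g = gcd a d"
  have g: "g > 0" using assms unfolding g_def by (simp add: order_less_le)
  define a0 d0 where "a0 = a div g" and "d0 = d div g"
  then have a0: "a = g * a0" and d0: "d = g * d0" by (simp_all add: g_def)
  obtain c0 where c0: "c = g * c0" using True unfolding g_def by (elim dvdE)
  have cop: "coprime a0 d0"
    unfolding \<open>a0 = a div g\<close> \<open>d0 = d div g\<close> g_def using assms by (intro div_gcd_coprime) auto
  have "d0 > 0" using d0 g assms by (simp add: zero_less_mult_iff)
  obtain u where "[a0 * u = 1] (mod d0)" using cong_solve_coprime_int[OF cop] by blast
  then have u: "d0 dvd (a0 * u - 1) * c0" by (simp add: cong_iff_dvd_diff)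
  \<comment> \<open>\<open>u\<close> inverts \<open>a0\<close> modulo \<open>d0\<close>, so \<open>- u * c0\<close> solves \<open>a0 * x + c0 \<equiv> 0\<close>.\<close>
  have "d dvd a * x + c \<longleftrightarrow> d0 dvd x - (- u * c0)" for x
  proof -
    have "a * x + c = g * (a0 * x + c0)" by (simp add: a0 c0 algebra_simps)
    then have "d dvd a * x + c \<longleftrightarrow> d0 dvd a0 * x + c0"
      using g by (simp add: d0)
    also have "a0 * x + c0 = a0 * (x - (- u * c0)) - (a0 * u - 1) * c0"
      by (simp add: algebra_simps)
    also have "d0 dvd \<dots> \<longleftrightarrow> d0 dvd a0 * (x - (- u * c0))"
      using u by (rule dvd_diff_left_iff)
    also have "\<dots> \<longleftrightarrow> d0 dvd x - (- u * c0)"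
      using cop by (intro coprime_dvd_mult_right_iff) (simp add: coprime_commute)
    finally show ?thesis .
  qed
  then have "{x \<in> {0..<t * d}. d dvd a * x + c} =
      {x \<in> {0..<(t * g) * d0}. d0 dvd x - (- u * c0)}"
    by (simp add: d0 mult.assoc)
  then have "int (card {x \<in> {0..<t * d}. d dvd a * x + c}) = t * g"
    using card_residue_class[of d0 "t * g" "- u * c0"] \<open>d0 > 0\<close> g assms by simp
  then show ?thesis using True by (simp add: g_def)
qed

section \<open>Counting lattice points of the dilated triangle\<close>

text \<open>
  With \<open>h = gcd b d\<close>, the column over \<open>x\<close> has a lattice point only if \<open>h\<close> divides \<open>a * x\<close>, hence
  \<open>x\<close>, as \<open>h\<close> is coprime to \<open>a\<close>. So \<open>t * d / h\<close> columns carry \<open>t * h\<close> points each.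
\<close>
lemma card_weight_lattice_square:
  fixes a b d t :: int
  assumes "d > 0" "t \<ge> 0" and cop: "gcd (gcd a b) d = 1"
  shows "int (card (weight_lattice a b d \<inter> ({0..<t * d} \<times> {0..<t * d}))) = t\<^sup>2 * d"
proof -
  define h where "h = gcd b d"
  have h: "h > 0" using assms unfolding h_def by (simp add: order_less_le)
  have "gcd h a = 1" using cop unfolding h_def by (simp only: ac_simps)
  then have "coprime h a" by (rule gcd_eq_1_imp_coprime)
  then have h_dvd: "h dvd a * x \<longleftrightarrow> h dvd x" for x by (rule coprime_dvd_mult_right_iff)
  have column: "int (card {y \<in> {0..<t * d}. d dvd a * x + b * y}) = (if h dvd x then t * h else 0)" for x
    using card_linear_congruence[of d t b "a * x"] assms h_dvd
    by (simp add: h_def add.commute)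
  obtain k where k: "d = k * h" unfolding h_def by (metis dvdE gcd_dvd2 mult.commute)
  have "k \<ge> 0" using k assms h by (metis zero_less_mult_pos2 order_less_imp_le)
  have rows: "int (card {x \<in> {0..<t * d}. h dvd x}) = t * k"
    using card_residue_class[of h "t * k" 0] h \<open>k \<ge> 0\<close> assms by (simp add: k mult.assoc)
  have fibres: "weight_lattice a b d \<inter> ({0..<t * d} \<times> {0..<t * d}) =
      (SIGMA x:{0..<t * d}. {y \<in> {0..<t * d}. d dvd a * x + b * y})"
    by (auto simp: weight_lattice_def)
  have "finite {y \<in> {0..<t * d}. d dvd a * x + b * y}" for x
    by (rule finite_subset[of _ "{0..<t * d}"]) auto
  then have "card (weight_lattice a b d \<inter> ({0..<t * d} \<times> {0..<t * d})) =
      (\<Sum>x\<in>{0..<t * d}. card {y \<in> {0..<t * d}. d dvd a * x + b * y})"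
    unfolding fibres by (intro card_SigmaI ballI) simp_all
  then have "int (card (weight_lattice a b d \<inter> ({0..<t * d} \<times> {0..<t * d}))) =
      (\<Sum>x\<in>{0..<t * d}. if h dvd x then t * h else 0)"
    by (simp only: of_nat_sum column)
  also have "\<dots> = int (card {x \<in> {0..<t * d}. h dvd x}) * (t * h)"
    by (simp add: sum.inter_filter[symmetric])
  also have "\<dots> = t\<^sup>2 * d" unfolding rows by (simp add: k power2_eq_square)
  finally show ?thesis .
qed

lemma card_insert_disjoint_Un:
  assumes "x \<notin> Q \<union> T \<union> R" "Q \<inter> T = {}" "(Q \<union> T) \<inter> R = {}"
    and "finite Q" "finite T" "finite R"
  shows "card (insert x (Q \<union> T \<union> R)) = Suc (card Q + card T + card R)"
  using assms by (simp add: card_Un_disjoint)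

text \<open>
  This is the Ehrhart polynomial of the triangle. The point reflection \<open>z \<mapsto> (td, td) - z\<close> preserves
  the lattice because \<open>(td, td)\<close> belongs to it, so the two halves of the closed square have equally
  many lattice points.
\<close>
lemma card_triangle_points:
  fixes a b d t :: int
  assumes d: "d > 0" and t: "t \<ge> 0" and cop: "gcd (gcd a b) d = 1"
  shows "2 * int (card (triangle_points a b d (t * d))) =
    d * t\<^sup>2 + (gcd a d + gcd b d + gcd (b - a) d) * t + 2"
proof -
  define s where "s = t * d"
  have s: "s \<ge> 0" using d t by (simp add: s_def)
  let ?L = "weight_lattice a b d"
  let ?lower = "triangle_points a b d s"
  let ?upper = "?L \<inter> {(x, y). x \<le> s \<and> y \<le> s \<and> s \<le> x + y}"
  let ?square = "?L \<inter> ({0..s} \<times> {0..s})"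
  let ?diag = "?L \<inter> {(x, y). 0 \<le> x \<and> x \<le> s \<and> x + y = s}"
  have corner: "(i * s, j * s) \<in> ?L" for i j
    by (simp add: weight_lattice_def s_def)
  have fin: "finite ?square" "finite ?lower" "finite ?upper" "finite ?diag"
  proof -
    show *: "finite ?square" by simp
    show "finite ?lower" by (rule finite_subset[OF _ *]) (auto simp: triangle_points_def)
    show "finite ?upper" by (rule finite_subset[OF _ *]) auto
    show "finite ?diag" by (rule finite_subset[OF _ *]) auto
  qed
  have "bij_betw (\<lambda>z. (s, s) - z) ?lower ?upper"
  proof (rule bij_betw_byWitness[where f' = "\<lambda>z. (s, s) - z"])
    have refl: "(s, s) - z \<in> ?L" if "z \<in> ?L" for z
      using weight_lattice_diff[OF corner[of 1 1] that] by simp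
    then show "(\<lambda>z. (s, s) - z) ` ?lower \<subseteq> ?upper"
      by (auto simp: triangle_points_def)
    from refl show "(\<lambda>z. (s, s) - z) ` ?upper \<subseteq> ?lower"
      by (auto simp: triangle_points_def)
  qed simp_all
  then have reflected: "card ?lower = card ?upper" by (rule bij_betw_same_card)
  have region: "0 \<le> x \<and> 0 \<le> y \<and> x + y \<le> s \<or> x \<le> s \<and> y \<le> s \<and> s \<le> x + y
      \<longleftrightarrow> 0 \<le> x \<and> x \<le> s \<and> 0 \<le> y \<and> y \<le> s" for x y
    using s by presburger
  have "?lower \<union> ?upper = ?square"
    unfolding triangle_points_def set_eq_iff using region by force
  moreover have "?lower \<inter> ?upper = ?diag"
    unfolding triangle_points_def set_eq_iff by force
  ultimately have double: "2 * card ?lower = card ?square + card ?diag"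
    using card_Un_Int[OF fin(2,3)] reflected by simp
  \<comment> \<open>On \<open>x + y = s\<close> the weight is \<open>(a - b) * x\<close> modulo \<open>d\<close>; the summand 1 is the end point \<open>x = s\<close>,
      missing from the half-open interval.\<close>
  have diag: "int (card ?diag) = t * gcd (b - a) d + 1"
  proof -
    let ?I = "{x \<in> {0..<s}. d dvd (a - b) * x + 0}"
    have eq: "a * x + b * (s - x) = (a - b) * x + d * (b * t)" for x
      by (simp add: s_def algebra_simps)
    have mem: "d dvd a * x + b * (s - x) \<longleftrightarrow> d dvd (a - b) * x + 0" for x
      unfolding eq by (simp add: dvd_add_left_iff)
    have "d dvd (a - b) * s + 0" by (simp add: s_def)
    have "z \<in> ?diag \<longleftrightarrow> z \<in> (\<lambda>x. (x, s - x)) ` insert s ?I" for z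
    proof -
      obtain x y where z: "z = (x, y)" by fastforce
      have "z \<in> ?diag \<longleftrightarrow> (0 \<le> x \<and> x \<le> s \<and> d dvd (a - b) * x + 0) \<and> y = s - x"
        unfolding z mem[symmetric] by (auto simp: weight_lattice_def)
      also have "0 \<le> x \<and> x \<le> s \<and> d dvd (a - b) * x + 0 \<longleftrightarrow> x \<in> insert s ?I"
        using s \<open>d dvd (a - b) * s + 0\<close> by (cases "x = s") auto
      also have "x \<in> insert s ?I \<and> y = s - x \<longleftrightarrow> z \<in> (\<lambda>x. (x, s - x)) ` insert s ?I"
        unfolding z by blast
      finally show ?thesis .
    qed
    then have "?diag = (\<lambda>x. (x, s - x)) ` insert s ?I" by (rule set_eqI)
    moreover have "inj_on (\<lambda>x. (x, s - x)) (insert s ?I)" by (simp add: inj_on_def)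
    ultimately have "card ?diag = card (insert s ?I)" by (simp only: card_image)
    moreover have "finite ?I" by (rule finite_subset[of _ "{0..<s}"]) auto
    ultimately have "card ?diag = Suc (card ?I)" by simp
    moreover have "gcd (a - b) d = gcd (b - a) d" by (metis gcd_neg1_int minus_diff_eq)
    ultimately show ?thesis
      using card_linear_congruence[OF d t, of "a - b" 0] by (simp add: s_def)
  qed
  \<comment> \<open>The closed square is the half-open one together with its top side, its right side and their
      common corner.\<close>
  have square: "int (card ?square) = t\<^sup>2 * d + t * gcd a d + t * gcd b d + 1"
  proof -
    let ?Q = "?L \<inter> ({0..<s} \<times> {0..<s})"
    let ?X = "{x \<in> {0..<s}. d dvd a * x + 0}" and ?Y = "{y \<in> {0..<s}. d dvd b * y + 0}"
    have top: "d dvd a * x + b * s \<longleftrightarrow> d dvd a * x + 0"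
      and right: "d dvd a * s + b * y \<longleftrightarrow> d dvd b * y + 0" for x y
      by (simp_all add: s_def dvd_add_left_iff dvd_add_right_iff)
    let ?T = "(\<lambda>x. (x, s)) ` ?X" and ?R = "(\<lambda>y. (s, y)) ` ?Y"
    have "z \<in> ?square \<longleftrightarrow> z \<in> insert (s, s) (?Q \<union> ?T \<union> ?R)" for z
    proof -
      obtain x y where z: "z = (x, y)" by fastforce
      have L: "(x, y) \<in> ?L \<longleftrightarrow> d dvd a * x + b * y" by (simp add: weight_lattice_def)
      consider "x = s" "y = s" | "x = s" "y \<noteq> s" | "x \<noteq> s" "y = s" | "x \<noteq> s" "y \<noteq> s" by blast
      then show ?thesis
      proof cases
        case 1
        then show ?thesis using s corner[of 1 1] z by simp
      next
        case 2
        then have "z \<in> ?square \<longleftrightarrow> y \<in> ?Y" using s right[of y] z L by auto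
        also have "\<dots> \<longleftrightarrow> z \<in> insert (s, s) (?Q \<union> ?T \<union> ?R)" using 2 z by auto
        finally show ?thesis .
      next
        case 3
        then have "z \<in> ?square \<longleftrightarrow> x \<in> ?X" using s top[of x] z L by auto
        also have "\<dots> \<longleftrightarrow> z \<in> insert (s, s) (?Q \<union> ?T \<union> ?R)" using 3 z by auto
        finally show ?thesis .
      next
        case 4
        then show ?thesis using z by auto
      qed
    qed
    then have square_eq: "?square = insert (s, s) (?Q \<union> ?T \<union> ?R)" by (rule set_eqI)
    have disjoint: "(s, s) \<notin> ?Q \<union> ?T \<union> ?R" "?Q \<inter> ?T = {}" "(?Q \<union> ?T) \<inter> ?R = {}"
      by auto
    have "finite ?Q" by simp
    moreover have "finite ?T" "finite ?R"
      by (rule finite_imageI, rule finite_subset[of _ "{0..<s}"], auto)+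
    ultimately have "card ?square = Suc (card ?Q + card ?T + card ?R)"
      unfolding square_eq by (rule card_insert_disjoint_Un[OF disjoint])
    moreover have "card ?T = card ?X" "card ?R = card ?Y"
      by (auto intro!: card_image simp: inj_on_def)
    ultimately show ?thesis
      using card_linear_congruence[OF d t, of a 0] card_linear_congruence[OF d t, of b 0]
        card_weight_lattice_square[OF d t cop] by (simp add: s_def)
  qed
  have "2 * int (card ?lower) = int (card ?square) + int (card ?diag)"
    using double by linarith
  then show ?thesis unfolding square diag by (simp add: s_def algebra_simps)
qed

section \<open>The Khovanskii polynomial of the GT-subset\<close>

lemma gcd_linear_combination_coprime:
  fixes k a' d' mu :: int
  assumes "coprime a' d'" shows "gcd (k * a' + mu * d') d' = gcd k d'"
proof -
  have "gcd (k * a' + mu * d') d' = gcd (k * a') d'"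
    using gcd_add_mult[of d' mu "k * a'"] by (simp only: ac_simps)
  also have "\<dots> = gcd k d'"
    using assms by (intro gcd_mult_left_right_cancel) (simp only: coprime_commute)
  finally show ?thesis .
qed

theorem proposition5p4:
  fixes d a11 a12 a' d' lam theta :: int and A :: "(nat \<times> nat) set"
  assumes "d > 2"
    and "0 \<le> a11" "a11 < d" "0 \<le> a12" "a12 < d"
    and "gcd (gcd a11 a12) d = 1"
    and "a' = a11 div gcd a11 d" "d' = d div gcd a11 d"
    and "0 < lam" "lam \<le> d'" "\<exists>mu. a12 = lam * a' + mu * d'"
    and "A = GT_subset a11 a12 d"
    and "theta = gcd a11 d + gcd lam d' + gcd (lam - gcd a11 d) d'"
  shows "phase_transition A = 0 \<and>
    (\<forall>t. of_nat (sumset_card A t) = poly (khovanskii_poly A) (of_nat t) \<and>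
         poly (khovanskii_poly A) (of_nat t) =
           (of_int d * of_nat t ^ 2 + of_int theta * of_nat t + 2) / 2)"
proof -
  define g where "g = gcd a11 d"
  have d: "d > 0" using assms(1) by simp
  have a11: "a11 = g * a'" and dg: "d = g * d'"
    using assms(7,8) by (simp_all add: g_def)
  obtain mu where mu: "a12 = lam * a' + mu * d'" using assms(11) by blast
  have cop': "coprime a' d'"
    unfolding assms(7,8) using d by (intro div_gcd_coprime) auto
  have "gcd a12 g = 1" using assms(6) unfolding g_def by (simp only: ac_simps)
  then have cop12: "coprime a12 g" by (rule gcd_eq_1_imp_coprime)
  \<comment> \<open>\<open>g\<close> divides \<open>a11\<close>, so \<open>a12 - a11\<close> inherits coprimality with \<open>g\<close> from \<open>a12\<close>.\<close>
  have "gcd (a12 - a11) g = gcd a12 g"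
    using gcd_add_mult[of g "- a'" a12] by (simp add: a11 gcd.commute algebra_simps)
  then have cop21: "coprime (a12 - a11) g"
    using \<open>gcd a12 g = 1\<close> by (intro gcd_eq_1_imp_coprime) simp
  have "gcd a12 d = gcd lam d'"
    using gcd_mult_right_left_cancel[OF cop12, of d'] gcd_linear_combination_coprime[OF cop', of lam mu]
    by (simp add: dg mu)
  moreover have "a12 - a11 = (lam - g) * a' + mu * d'"
    by (simp add: mu a11 algebra_simps)
  then have "gcd (a12 - a11) d = gcd (lam - g) d'"
    using gcd_mult_right_left_cancel[OF cop21, of d'] gcd_linear_combination_coprime[OF cop', of "lam - g" mu]
    by (simp add: dg)
  ultimately have theta: "theta = gcd a11 d + gcd a12 d + gcd (a12 - a11) d"
    using assms(13) by (simp add: g_def)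
  define p :: "rat poly" where "p = [:1, of_int theta / 2, of_int d / 2:]"
  have p: "poly p x = (of_int d * x ^ 2 + of_int theta * x + 2) / 2" for x
    by (simp add: p_def field_simps power2_eq_square)
  have count: "of_nat (sumset_card A t) = poly p (of_nat t)" for t
  proof -
    have "2 * int (sumset_card A t) = d * (int t)\<^sup>2 + theta * int t + 2"
      using card_triangle_points[OF d _ assms(6), of "int t"] sumset_card_GT_subset[OF d]
      by (simp add: assms(12) theta)
    then have "(of_int (2 * int (sumset_card A t)) :: rat)
        = of_int (d * (int t)\<^sup>2 + theta * int t + 2)" by (rule arg_cong)
    then show ?thesis by (simp add: p)
  qed
  then have poly: "khovanskii_poly A = p" by (intro khovanskii_poly_eqI) simp
  then have "phase_transition A = 0"
    unfolding phase_transition_def by (intro Least_eq_0) (simp add: count)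
  then show ?thesis by (simp add: poly count p)
qed

end
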